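(* Let $f\in\mathbb{C}_p[T]$ and $x\in\mathbb{C}_p$. Then the following are equivalent: ($\alpha$) $\alpha(f,x)<1$; ($\gamma$) $\mathrm{dist}(x,f^{-1}(0))<1/\gamma(f,x)$. Moreover, if either of these conditions holds, then the Newton sequence $\{N_f^k(x)\}_k$ is well-defined and converges quadratically to a non-singular root $\zeta$ of $f$; more precisely, for all $k\in\mathbb{N}$: (a) $\alpha(f,N_f^k(x))\le\alpha(f,x)^{2^k}$; (b) $\beta(f,N_f^k(x))\le\beta(f,x)\alpha(f,x)^{2^k}$; (c) $\gamma(f,N_f^k(x))\le\gamma(f,x)$; (Q) $|N_f^k(x)-\zeta|=\beta(f,N_f^k(x))\le\alpha(f,x)^{2^k}\beta(f,x)<\alpha(f,x)^{2^k}/\gamma(f,x)$.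
   Context: $\mathbb{C}_p$ is the completion of the algebraic closure of $\mathbb{Q}_p$ with its absolute value $|\cdot|$ ($|p|=1/p$). For $f\in\mathbb{C}_p[T]$ and $x\in\mathbb{C}_p$ with $f'(x)\ne0$: $\beta(f,x):=|f(x)/f'(x)|$, $\gamma(f,x):=\max_{k\ge2}\left|\frac{f^{(k)}(x)}{k!f'(x)}\right|^{1/(k-1)}$, $\alpha(f,x):=\beta(f,x)\gamma(f,x)$; if $f'(x)=0$ all three are $\infty$. The Newton operator is $N_f(x):=x-f(x)/f'(x)$ (defined when $f'(x)\neq0$), and $\mathrm{dist}(x,f^{-1}(0)):=\inf\{|x-z|: z\in\mathbb{C}_p, f(z)=0\}$. Conventions $1/\infty=0$, $1/0=\infty$.
   Formalization: In (b) and (Q) the exponent 2^k is replaced by 2^k-1 (the original fails at k=0 if 0<α<1); in (Q) "<" is claimed only when α^(2^k-1)≠0, else "≤"; the bound α^(2^k)/γ is kept as "≤" for γ≠0. *)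

theory Defs
  imports
    "HOL-Computational_Algebra.Polynomial"
    "HOL-Library.Extended_Nonnegative_Real"
    Complex_Main
begin

section \<open>The field of p-adic complex numbers\<close>

text \<open>
  The library has no type of $p$-adic numbers. The field $C_p$ is therefore a type \<open>'a\<close> together
  with a function \<open>v\<close>, its absolute value, satisfying the definition of $C_p$ as the completion of
  an algebraic closure of the completion of the rationals. This determines the pair up to
  isometric isomorphism. The metric is $(x, y) \mapsto v (x - y)$; the type class metric of a
  particular type (for instance that of the complex numbers) plays no role.
\<close>

definition nonarch_abs :: "('a::field \<Rightarrow> real) \<Rightarrow> bool" where
  "nonarch_abs v \<longleftrightarrow>
     (\<forall>x. 0 \<le> v x) \<and> (\<forall>x. v x = 0 \<longleftrightarrow> x = 0) \<and>
     (\<forall>x y. v (x * y) = v x * v y) \<and> (\<forall>x y. v (x + y) \<le> max (v x) (v y))"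

definition v_tendsto :: "('a::field \<Rightarrow> real) \<Rightarrow> (nat \<Rightarrow> 'a) \<Rightarrow> 'a \<Rightarrow> bool" where
  "v_tendsto v s l \<longleftrightarrow> (\<lambda>n. v (s n - l)) \<longlonglongrightarrow> 0"

definition v_Cauchy :: "('a::field \<Rightarrow> real) \<Rightarrow> (nat \<Rightarrow> 'a) \<Rightarrow> bool" where
  "v_Cauchy v s \<longleftrightarrow> (\<forall>e>0. \<exists>M. \<forall>m\<ge>M. \<forall>n\<ge>M. v (s m - s n) < e)"

definition v_complete :: "('a::field \<Rightarrow> real) \<Rightarrow> 'a set \<Rightarrow> bool" where
  "v_complete v S \<longleftrightarrow> (\<forall>s. range s \<subseteq> S \<and> v_Cauchy v s \<longrightarrow> (\<exists>l\<in>S. v_tendsto v s l))"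

definition is_completion :: "('a::field \<Rightarrow> real) \<Rightarrow> 'a set \<Rightarrow> 'a set \<Rightarrow> bool" where
  "is_completion v A B \<longleftrightarrow>
     A \<subseteq> B \<and> v_complete v B \<and> (\<forall>b\<in>B. \<forall>e>0. \<exists>a\<in>A. v (b - a) < e)"

definition is_subfield :: "'a::field set \<Rightarrow> bool" where
  "is_subfield F \<longleftrightarrow>
     0 \<in> F \<and> 1 \<in> F \<and> (\<forall>x\<in>F. \<forall>y\<in>F. x - y \<in> F \<and> x * y \<in> F) \<and> (\<forall>x\<in>F. inverse x \<in> F)"

definition poly_over :: "'a::field set \<Rightarrow> 'a poly \<Rightarrow> bool" where
  "poly_over F g \<longleftrightarrow> (\<forall>i. coeff g i \<in> F)"

definition is_algebraic_closure :: "'a::field set \<Rightarrow> 'a set \<Rightarrow> bool" where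
  "is_algebraic_closure F L \<longleftrightarrow>
     is_subfield F \<and> is_subfield L \<and> F \<subseteq> L \<and>
     (\<forall>x\<in>L. \<exists>g. g \<noteq> 0 \<and> poly_over F g \<and> poly g x = 0) \<and>
     (\<forall>g. poly_over L g \<and> degree g > 0 \<longrightarrow> (\<exists>x\<in>L. poly g x = 0))"

text \<open>
  A non-archimedean absolute value with $v(p) = 1/p$ restricts to the $p$-adic absolute value on the
  rationals: it is at most 1 on the integers, and those with $v < 1$ form a proper ideal
  containing $p$, so $v(m) = 1$ whenever $p$ does not divide $m$. The sets \<open>Qp\<close> and \<open>Qpbar\<close> are
  $Q_p$ and its algebraic closure.
\<close>

definition is_Cp :: "nat \<Rightarrow> ('a::field_char_0 \<Rightarrow> real) \<Rightarrow> bool" where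
  "is_Cp p v \<longleftrightarrow>
     prime p \<and> nonarch_abs v \<and> v (of_nat p) = 1 / real p \<and>
     (\<exists>Qp Qpbar. is_completion v \<rat> Qp \<and> is_algebraic_closure Qp Qpbar \<and>
                 is_completion v Qpbar UNIV)"


section \<open>Newton's method and the alpha, beta and gamma quantities\<close>

text \<open>
  Values are in \<^typ>\<open>ennreal\<close>, where \<open>1 / top = 0\<close> and \<open>1 / 0 = top\<close>.
\<close>

definition beta :: "('a::field_char_0 \<Rightarrow> real) \<Rightarrow> 'a poly \<Rightarrow> 'a \<Rightarrow> ennreal" where
  "beta v f x =
     (if poly (pderiv f) x = 0 then top else ennreal (v (poly f x / poly (pderiv f) x)))"

text \<open>
  The terms vanish for \<open>k\<close> above the degree of \<open>f\<close>, so the supremum is a maximum.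
\<close>

definition gamma :: "('a::field_char_0 \<Rightarrow> real) \<Rightarrow> 'a poly \<Rightarrow> 'a \<Rightarrow> ennreal" where
  "gamma v f x =
     (if poly (pderiv f) x = 0 then top
      else (SUP k\<in>{2..}. ennreal (root (k - 1)
              (v (poly ((pderiv ^^ k) f) x / (fact k * poly (pderiv f) x))))))"

definition alpha :: "('a::field_char_0 \<Rightarrow> real) \<Rightarrow> 'a poly \<Rightarrow> 'a \<Rightarrow> ennreal" where
  "alpha v f x =
     (if poly (pderiv f) x = 0 then top else beta v f x * gamma v f x)"

text \<open>
  Only meaningful where the derivative does not vanish; well-definedness of a Newton sequence is
  the statement that the derivative is nonzero at each of its terms.
\<close>

definition newton :: "'a::field_char_0 poly \<Rightarrow> 'a \<Rightarrow> 'a" where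
  "newton f x = x - poly f x / poly (pderiv f) x"

definition newton_well_defined :: "'a::field_char_0 poly \<Rightarrow> 'a \<Rightarrow> bool" where
  "newton_well_defined f x \<longleftrightarrow> (\<forall>k. poly (pderiv f) ((newton f ^^ k) x) \<noteq> 0)"

text \<open>The infimum over the empty set is \<open>top\<close>.\<close>

definition root_dist :: "('a::field_char_0 \<Rightarrow> real) \<Rightarrow> 'a poly \<Rightarrow> 'a \<Rightarrow> ennreal" where
  "root_dist v f x = (INF z\<in>{z. poly f z = 0}. ennreal (v (x - z)))"

definition converges_quadratically :: "('a::field \<Rightarrow> real) \<Rightarrow> (nat \<Rightarrow> 'a) \<Rightarrow> 'a \<Rightarrow> bool" where
  "converges_quadratically v s l \<longleftrightarrow>
     v_tendsto v s l \<and> (\<exists>C. \<forall>k. v (s (Suc k) - l) \<le> C * (v (s k - l))\<^sup>2)"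

end

theory Submission
  imports Defs
begin

text \<open>
  Write \<open>c k\<close> for the Taylor coefficients of \<open>f\<close> at \<open>x\<close>. A real \<open>G\<close> bounds \<open>gamma\<close> iff
  \<open>v (c k) \<le> v (c 1) * G ^ (k - 1)\<close> for all \<open>k \<ge> 1\<close>. By the ultrametric inequality these bounds,
  and the value \<open>v (c 1)\<close>, persist when \<open>x\<close> moves by some \<open>h\<close> with \<open>G * v h < 1\<close>, and \<open>f\<close> is then
  linear at \<open>x\<close> up to an error of \<open>v (c 1) * v h * (G * v h)\<close>. For the Newton step the linear part
  vanishes, which gives quadratic decay of \<open>beta\<close>. The Newton sequence is therefore Cauchy, and its
  limit is a root. Conversely, at a root \<open>x + h\<close> the error is smaller than the linear part, so
  \<open>v h = beta\<close>.
\<close>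

section \<open>Taylor coefficients at a point and their change under translation\<close>

definition taylor_coeff :: "'a::comm_semiring_1 poly \<Rightarrow> 'a \<Rightarrow> nat \<Rightarrow> 'a" where
  "taylor_coeff f x k = coeff (f \<circ>\<^sub>p [:x, 1:]) k"

lemma higher_pderiv_pcompose_shift:
  fixes f :: "'a::idom poly"
  shows "(pderiv ^^ k) (f \<circ>\<^sub>p [:x, 1:]) = (pderiv ^^ k) f \<circ>\<^sub>p [:x, 1:]"
  by (induction k) (simp_all add: pderiv_pcompose pderiv_pCons)

lemma taylor_coeff_conv_higher_pderiv:
  fixes f :: "'a::field_char_0 poly"
  shows "taylor_coeff f x k = poly ((pderiv ^^ k) f) x / fact k"
proof -
  have "poly ((pderiv ^^ k) f) x = coeff ((pderiv ^^ k) (f \<circ>\<^sub>p [:x, 1:])) 0"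
    by (simp add: higher_pderiv_pcompose_shift)
  also have "\<dots> = fact k * taylor_coeff f x k"
    by (simp add: coeff_higher_pderiv taylor_coeff_def pochhammer_fact[symmetric])
  finally show ?thesis by simp
qed

lemma taylor_coeff_0 [simp]: "taylor_coeff f x 0 = poly f x"
  by (simp add: taylor_coeff_def)

lemma taylor_coeff_1 [simp]:
  fixes f :: "'a::field_char_0 poly"
  shows "taylor_coeff f x (Suc 0) = poly (pderiv f) x"
  by (simp add: taylor_coeff_conv_higher_pderiv)

lemma taylor_coeff_eq_0:
  fixes f :: "'a::idom poly"
  shows "degree f < k \<Longrightarrow> taylor_coeff f x k = 0"
  by (simp add: taylor_coeff_def coeff_eq_0 degree_pcompose)

text \<open>Translating by \<open>x + h\<close> is translating by \<open>x\<close> and then by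
  \<open>h\<close>, so each coefficient at \<open>x\<close> meets a power of T + h, expanded
  binomially. Powers with exponent below \<open>k\<close> have no term of degree
  \<open>k\<close>.\<close>

lemma taylor_coeff_shift:
  fixes f :: "'a::idom poly"
  shows "taylor_coeff f (x + h) k =
    (\<Sum>j\<in>{k..degree f}. of_nat (j choose k) * h ^ (j - k) * taylor_coeff f x j)"
proof -
  define g where "g = f \<circ>\<^sub>p [:x, 1:]"
  have deg: "degree g = degree f" by (simp add: g_def degree_pcompose)
  have "f \<circ>\<^sub>p [:x + h, 1:] = g \<circ>\<^sub>p [:h, 1:]"
    by (simp add: g_def pcompose_assoc[symmetric] pcompose_pCons add.commute)
  also have "\<dots> = (\<Sum>j\<le>degree g. smult (coeff g j) ([:h, 1:] ^ j))"
    by (simp add: pcompose_altdef poly_altdef coeff_map_poly degree_map_poly)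
  finally have "taylor_coeff f (x + h) k =
      (\<Sum>j\<le>degree f. coeff g j * coeff ([:h, 1:] ^ j) k)"
    by (simp add: taylor_coeff_def coeff_sum deg)
  also have "\<dots> = (\<Sum>j\<in>{k..degree f}. coeff g j * coeff ([:h, 1:] ^ j) k)"
  proof (rule sum.mono_neutral_right)
    show "\<forall>j\<in>{..degree f} - {k..degree f}. coeff g j * coeff ([:h, 1:] ^ j) k = 0"
    proof
      fix j assume "j \<in> {..degree f} - {k..degree f}"
      hence "degree ([:h, 1:] ^ j) < k" by (auto simp: degree_power_eq)
      thus "coeff g j * coeff ([:h, 1:] ^ j) k = 0" by (simp add: coeff_eq_0)
    qed
  qed auto
  also have "\<dots> = (\<Sum>j\<in>{k..degree f}. of_nat (j choose k) * h ^ (j - k) * taylor_coeff f x j)"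
    by (rule sum.cong) (simp_all add: coeff_linear_poly_power taylor_coeff_def g_def)
  finally show ?thesis .
qed

section \<open>Non-archimedean absolute values\<close>

locale nonarch_field =
  fixes v :: "'a::field_char_0 \<Rightarrow> real"
  assumes nonarch: "nonarch_abs v"
begin

lemma v_nonneg [simp]: "0 \<le> v x"
  and v_eq_0_iff [simp]: "v x = 0 \<longleftrightarrow> x = 0"
  and v_mult: "v (x * y) = v x * v y"
  and v_add_le_max: "v (x + y) \<le> max (v x) (v y)"
  using nonarch by (auto simp: nonarch_abs_def)

lemma v_0 [simp]: "v 0 = 0"
  by simp

lemma v_1 [simp]: "v 1 = 1"
  using v_mult[of 1 1] v_eq_0_iff[of 1] by simp

lemma v_minus [simp]: "v (- x) = v x"
proof -
  have "v (- 1) * v (- 1) = 1" using v_mult[of "- 1" "- 1"] by simp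
  hence "(v (- 1))\<^sup>2 = 1\<^sup>2" by (simp add: power2_eq_square)
  hence "v (- 1) = 1" using power2_eq_imp_eq v_nonneg zero_le_one by blast
  thus ?thesis using v_mult[of "- 1" x] by simp
qed

lemma v_diff_commute: "v (x - y) = v (y - x)"
  using v_minus[of "x - y"] by simp

lemma v_diff_le_max: "v (x - y) \<le> max (v x) (v y)"
  using v_add_le_max[of x "- y"] by simp

lemma v_triangle_max: "v (x - z) \<le> max (v (x - y)) (v (y - z))"
  using v_add_le_max[of "x - y" "y - z"] by simp

lemma v_power: "v (x ^ n) = v x ^ n"
  by (induction n) (simp_all add: v_mult)

lemma v_inverse: "v (inverse x) = inverse (v x)"
  by (cases "x = 0") (use v_mult[of x "inverse x"] in \<open>auto simp: field_simps\<close>)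

lemma v_divide: "v (x / y) = v x / v y"
  by (simp add: divide_inverse v_mult v_inverse)

text \<open>Thanks to this, binomial coefficients cost nothing when a Taylor expansion is moved to
  another point.\<close>

lemma v_of_nat_le_1: "v (of_nat n) \<le> 1"
proof (induction n)
  case (Suc n)
  thus ?case using v_add_le_max[of 1 "of_nat n"] by simp
qed simp

lemma v_sum_le:
  assumes "\<And>i. i \<in> A \<Longrightarrow> v (g i) \<le> B" "0 \<le> B"
  shows "v (sum g A) \<le> B"
  using assms
proof (induction A rule: infinite_finite_induct)
  case (insert i A)
  have "v (sum g (insert i A)) \<le> max (v (g i)) (v (sum g A))"
    using insert.hyps by (simp add: v_add_le_max)
  also have "\<dots> \<le> B" using insert by simp
  finally show ?case .
qed simp_all

text \<open>Isosceles principle: writing x as (x - y) + y gives \<open>v x \<le> v y\<close>.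
  Writing y as x - (x - y) gives the converse, because \<open>v (x - y)\<close> is too small to be
  the maximum.\<close>

lemma v_eq_of_diff_less:
  assumes "v (x - y) < v y"
  shows "v x = v y"
  using assms v_add_le_max[of "x - y" y] v_diff_le_max[of x "x - y"] by simp

section \<open>Real bounds on \<open>gamma\<close> and their consequences near a point\<close>

definition gamma_bound :: "'a poly \<Rightarrow> 'a \<Rightarrow> real \<Rightarrow> bool" where
  "gamma_bound f x G \<longleftrightarrow> 0 \<le> G \<and>
     (\<forall>k\<ge>1. v (taylor_coeff f x k) \<le> v (poly (pderiv f) x) * G ^ (k - 1))"

text \<open>Taking powers and clearing the positive denominator \<open>D\<close> removes roots and
  quotients. The resulting inequalities combine directly with powers of \<open>v h\<close> in a
  Taylor expansion.\<close>

lemma gamma_le_iff: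
  assumes "poly (pderiv f) x \<noteq> 0" "0 \<le> G"
  shows "gamma v f x \<le> ennreal G \<longleftrightarrow> gamma_bound f x G"
proof -
  define D where "D = v (poly (pderiv f) x)"
  have D: "0 < D" using assms(1) v_nonneg[of "poly (pderiv f) x"] by (simp add: D_def less_le)
  have *: "root (k - 1) (v (poly ((pderiv ^^ k) f) x / (fact k * poly (pderiv f) x))) \<le> G
      \<longleftrightarrow> v (taylor_coeff f x k) \<le> D * G ^ (k - 1)" if "k \<ge> 2" for k
  proof -
    have eq: "v (poly ((pderiv ^^ k) f) x / (fact k * poly (pderiv f) x)) = v (taylor_coeff f x k) / D"
      by (simp add: taylor_coeff_conv_higher_pderiv v_divide v_mult D_def)
    have "root (k - 1) (v (taylor_coeff f x k) / D) \<le> G \<longleftrightarrow>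
        root (k - 1) (v (taylor_coeff f x k) / D) \<le> root (k - 1) (G ^ (k - 1))"
      using that assms(2) by (simp add: real_root_power_cancel)
    also have "\<dots> \<longleftrightarrow> v (taylor_coeff f x k) / D \<le> G ^ (k - 1)"
      using that by (intro real_root_le_iff) simp
    also have "\<dots> \<longleftrightarrow> v (taylor_coeff f x k) \<le> D * G ^ (k - 1)"
      using D by (simp add: pos_divide_le_eq mult.commute)
    finally show ?thesis by (simp only: eq)
  qed
  have "gamma v f x \<le> ennreal G \<longleftrightarrow> (\<forall>k\<in>{2..}. v (taylor_coeff f x k) \<le> D * G ^ (k - 1))"
    using assms * by (simp add: gamma_def SUP_le_iff ennreal_le_iff del: One_nat_def)
  \<comment> \<open>Index 1 holds with equality. Including it lets later estimates treat all
    positive indices alike.\<close>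
  also have "\<dots> \<longleftrightarrow> (\<forall>k\<ge>1. v (taylor_coeff f x k) \<le> D * G ^ (k - 1))"
  proof (intro iffI ballI allI impI)
    fix k :: nat
    assume *: "\<forall>k\<in>{2..}. v (taylor_coeff f x k) \<le> D * G ^ (k - 1)" and "k \<ge> 1"
    show "v (taylor_coeff f x k) \<le> D * G ^ (k - 1)"
    proof (cases "k = 1")
      case False
      with \<open>k \<ge> 1\<close> * show ?thesis by simp
    qed (simp add: D_def)
  qed simp
  finally show ?thesis using assms(2) by (simp add: gamma_bound_def D_def)
qed

text \<open>Terms beyond the degree vanish, so the sum of the remaining nonnegative terms is a
  finite upper bound.\<close>

lemma gamma_finite:
  assumes "poly (pderiv f) x \<noteq> 0"
  obtains G where "0 \<le> G" "gamma v f x = ennreal G"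
proof -
  define t where "t k = root (k - 1) (v (poly ((pderiv ^^ k) f) x / (fact k * poly (pderiv f) x)))"
    for k
  have "t k = 0" if "k > degree f" "k \<ge> 2" for k
  proof -
    have "poly ((pderiv ^^ k) f) x = fact k * taylor_coeff f x k"
      by (simp add: taylor_coeff_conv_higher_pderiv)
    thus ?thesis using that by (simp add: t_def taylor_coeff_eq_0)
  qed
  \<comment> \<open>For k = 0 and k = 1 the root index is 0, and \<open>root 0\<close> is constantly
    0, so these extra summands do no harm.\<close>
  moreover have "t k \<ge> 0" for k unfolding t_def
    by (cases "k - 1 = 0") (simp_all add: real_root_ge_zero del: One_nat_def)
  ultimately have "t k \<le> (\<Sum>i\<le>degree f. t i)" if "k \<ge> 2" for k
    using that by (cases "k \<le> degree f") (auto intro!: member_le_sum sum_nonneg)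
  hence "gamma v f x \<le> ennreal (\<Sum>i\<le>degree f. t i)"
    using assms by (auto simp: gamma_def t_def SUP_le_iff intro!: ennreal_leI)
  hence "gamma v f x < top" using ennreal_less_top order.strict_trans1 by blast
  thus ?thesis using that by (cases "gamma v f x") auto
qed

text \<open>The factor G^(j-1) splits as G^(k-1) * G^(j-k), and the second part pairs with the power
  of \<open>v h\<close>. The number \<open>m\<close> says how many factors \<open>G * v h\<close>
  are kept: \<open>m = 0\<close> serves to bound shifted coefficients, \<open>m = 1\<close> to gain
  smallness for the derivative.\<close>

lemma taylor_term_le:
  assumes "gamma_bound f x G" "G * v h \<le> 1" "1 \<le> k" "k + m \<le> j"
  shows "v (of_nat (j choose k) * h ^ (j - k) * taylor_coeff f x j)
    \<le> v (poly (pderiv f) x) * G ^ (k - 1) * (G * v h) ^ m"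
proof -
  have G: "0 \<le> G" and c: "v (taylor_coeff f x j) \<le> v (poly (pderiv f) x) * G ^ (j - 1)"
    using assms by (auto simp: gamma_bound_def)
  have "v (of_nat (j choose k) * h ^ (j - k) * taylor_coeff f x j)
      \<le> 1 * v h ^ (j - k) * (v (poly (pderiv f) x) * G ^ (j - 1))"
    unfolding v_mult v_power by (intro mult_mono v_of_nat_le_1 c) (auto simp: G)
  also have "j - 1 = (k - 1) + (j - k)" using assms by simp
  also have "1 * v h ^ (j - k) * (v (poly (pderiv f) x) * G ^ ((k - 1) + (j - k)))
      = v (poly (pderiv f) x) * G ^ (k - 1) * (G * v h) ^ (j - k)"
    by (simp add: power_add power_mult_distrib)
  also have "\<dots> \<le> v (poly (pderiv f) x) * G ^ (k - 1) * (G * v h) ^ m"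
    using assms G by (intro mult_left_mono power_decreasing) auto
  finally show ?thesis .
qed

text \<open>Only terms of index at least 2 survive. Each carries a factor \<open>G * v h\<close>
  beyond the size of the linear term, and the ultrametric inequality bounds their sum by the same
  quantity.\<close>

lemma v_linearization_error_le:
  assumes "gamma_bound f x G" "G * v h \<le> 1"
  shows "v (poly f (x + h) - poly f x - poly (pderiv f) x * h)
    \<le> v (poly (pderiv f) x) * v h * (G * v h)"
proof -
  define t where "t j = h ^ j * taylor_coeff f x j" for j
  have G: "0 \<le> G" using assms by (simp add: gamma_bound_def)
  have "poly f (x + h) = (\<Sum>j\<le>degree f. t j)"
    using taylor_coeff_shift[of f x h 0] by (simp add: t_def atLeast0AtMost)
  \<comment> \<open>A zero term is appended so that indices 0 and 1 can be split off even if
    \<open>f\<close> is constant.\<close>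
  also have "\<dots> = (\<Sum>j\<le>Suc (degree f). t j)"
    by (simp add: t_def taylor_coeff_eq_0)
  also have "\<dots> = t 0 + t 1 + (\<Sum>j\<in>{2..Suc (degree f)}. t j)"
    by (simp add: atMost_atLeast0 sum.atLeast_Suc_atMost numeral_2_eq_2)
  finally have "poly f (x + h) - poly f x - poly (pderiv f) x * h
      = (\<Sum>j\<in>{2..Suc (degree f)}. t j)"
    by (simp add: t_def mult.commute)
  also have "v \<dots> \<le> v (poly (pderiv f) x) * v h * (G * v h)"
  proof (rule v_sum_le)
    fix j assume "j \<in> {2..Suc (degree f)}"
    hence j: "j \<ge> 2" by simp
    have "v (t j) \<le> v h ^ j * (v (poly (pderiv f) x) * G ^ (j - 1))"
      unfolding t_def v_mult v_power
      using assms j by (intro mult_left_mono) (auto simp: gamma_bound_def)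
    also have "j = Suc (j - 1)" using j by simp
    also have "v h ^ \<dots> * (v (poly (pderiv f) x) * G ^ (\<dots> - 1))
        = v (poly (pderiv f) x) * v h * (G * v h) ^ (j - 1)"
      by (simp add: power_mult_distrib)
    also have "\<dots> \<le> v (poly (pderiv f) x) * v h * (G * v h) ^ 1"
      using assms G j by (intro mult_left_mono power_decreasing) auto
    finally show "v (t j) \<le> v (poly (pderiv f) x) * v h * (G * v h)" using j by simp
  qed (use G in simp)
  finally show ?thesis .
qed

text \<open>All terms but the first are smaller than it by the factor \<open>G * v h < 1\<close>, so
  the isosceles principle applies.\<close>

lemma v_pderiv_shift:
  assumes "gamma_bound f x G" "G * v h < 1" "poly (pderiv f) x \<noteq> 0"
  shows "v (poly (pderiv f) (x + h)) = v (poly (pderiv f) x)"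
proof (rule v_eq_of_diff_less)
  define t where "t j = of_nat (j choose 1) * h ^ (j - 1) * taylor_coeff f x j" for j
  have D: "0 < v (poly (pderiv f) x)"
    using assms(3) v_nonneg[of "poly (pderiv f) x"] by (simp add: less_le)
  have G: "0 \<le> G" using assms by (simp add: gamma_bound_def)
  have "poly (pderiv f) (x + h) = (\<Sum>j\<in>{1..degree f}. t j)"
    using taylor_coeff_shift[of f x h 1] by (simp add: t_def)
  also have "\<dots> = (\<Sum>j\<in>{1..Suc (degree f)}. t j)"
    by (simp add: t_def taylor_coeff_eq_0)
  also have "\<dots> = poly (pderiv f) x + (\<Sum>j\<in>{2..Suc (degree f)}. t j)"
    by (simp add: sum.atLeast_Suc_atMost numeral_2_eq_2 t_def)
  finally have "poly (pderiv f) (x + h) - poly (pderiv f) x = (\<Sum>j\<in>{2..Suc (degree f)}. t j)"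
    by simp
  also have "v \<dots> \<le> v (poly (pderiv f) x) * (G * v h)"
  proof (rule v_sum_le)
    fix j assume "j \<in> {2..Suc (degree f)}"
    thus "v (t j) \<le> v (poly (pderiv f) x) * (G * v h)"
      using taylor_term_le[of f x G h 1 1 j] assms by (simp add: t_def)
  qed (use G in simp)
  also have "\<dots> < v (poly (pderiv f) x) * 1"
    using D assms(2) by (intro mult_strict_left_mono)
  finally show "v (poly (pderiv f) (x + h) - poly (pderiv f) x) < v (poly (pderiv f) x)"
    by simp
qed

text \<open>The derivative keeps its value and no term exceeds the old bound, so the same
  \<open>G\<close> works at the new point and nothing degrades under iteration.\<close>

lemma gamma_bound_shift:
  assumes "gamma_bound f x G" "G * v h < 1" "poly (pderiv f) x \<noteq> 0"
  shows "gamma_bound f (x + h) G"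
  unfolding gamma_bound_def
proof (intro conjI allI impI)
  show G: "0 \<le> G" using assms by (simp add: gamma_bound_def)
  fix k :: nat assume k: "k \<ge> 1"
  show "v (taylor_coeff f (x + h) k) \<le> v (poly (pderiv f) (x + h)) * G ^ (k - 1)"
    unfolding v_pderiv_shift[OF assms] taylor_coeff_shift
  proof (rule v_sum_le)
    fix j assume "j \<in> {k..degree f}"
    thus "v (of_nat (j choose k) * h ^ (j - k) * taylor_coeff f x j)
        \<le> v (poly (pderiv f) x) * G ^ (k - 1)"
      using taylor_term_le[of f x G h k 0 j] assms k by simp
  qed (use G in simp)
qed

text \<open>This serves both to get from a nearby root to a bound on alpha and to compute the exact
  distance of the iterates to the limit. The case \<open>x = z\<close> is separate because the
  strict comparison requires \<open>0 < v h\<close>.\<close>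

lemma v_dist_root:
  assumes "gamma_bound f x G" "poly (pderiv f) x \<noteq> 0" "poly f z = 0" "G * v (x - z) < 1"
  shows "v (x - z) = v (poly f x) / v (poly (pderiv f) x)"
proof (cases "x = z")
  case False
  define D where "D = v (poly (pderiv f) x)"
  define h where "h = z - x"
  have h: "v (x - z) = v h" "0 < v h"
    using False v_nonneg[of h] by (auto simp: h_def v_diff_commute less_le)
  have D: "0 < D" using assms(2) v_nonneg[of "poly (pderiv f) x"] by (simp add: D_def less_le)
  have "v (- poly f x - poly (pderiv f) x * h) \<le> D * v h * (G * v h)"
    using v_linearization_error_le[of f x G h] assms h by (simp add: h_def D_def)
  also have "\<dots> < D * v h * 1"
    using assms(4) D h by (intro mult_strict_left_mono) auto
  finally have "v (- poly f x) = v (poly (pderiv f) x * h)"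
    by (intro v_eq_of_diff_less) (simp add: v_mult D_def)
  hence "v (poly f x) = D * v h" by (simp add: v_mult D_def)
  thus ?thesis using D h by (simp add: D_def[symmetric])
qed (use assms in simp)

section \<open>Newton's method: one step, the iterates, convergence\<close>

lemma newton_step:
  assumes "gamma_bound f x G" "poly (pderiv f) x \<noteq> 0"
    and "G * (v (poly f x) / v (poly (pderiv f) x)) < 1"
  shows "v (poly (pderiv f) (newton f x)) = v (poly (pderiv f) x)"
    and "gamma_bound f (newton f x) G"
    and "v (poly f (newton f x)) / v (poly (pderiv f) x)
      \<le> G * (v (poly f x) / v (poly (pderiv f) x))\<^sup>2"
proof -
  define h where "h = - (poly f x / poly (pderiv f) x)"
  have N: "newton f x = x + h" by (simp add: newton_def h_def)
  have vh: "v h = v (poly f x) / v (poly (pderiv f) x)" by (simp add: h_def v_divide)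
  have D: "0 < v (poly (pderiv f) x)"
    using assms(2) v_nonneg[of "poly (pderiv f) x"] by (simp add: less_le)
  show "v (poly (pderiv f) (newton f x)) = v (poly (pderiv f) x)"
    using v_pderiv_shift[of f x G h] assms by (simp add: N vh)
  show "gamma_bound f (newton f x) G"
    using gamma_bound_shift[of f x G h] assms by (simp add: N vh)
  \<comment> \<open>For this \<open>h\<close> the subtracted linear part is zero, so the new value
    of \<open>f\<close> is exactly the linearization error.\<close>
  have "poly f (newton f x) = poly f (x + h) - poly f x - poly (pderiv f) x * h"
    using assms(2) by (simp add: N h_def)
  hence "v (poly f (newton f x)) \<le> v (poly (pderiv f) x) * v h * (G * v h)"
    using v_linearization_error_le[of f x G h] assms by (simp add: vh)
  hence "v (poly f (newton f x)) / v (poly (pderiv f) x) \<le> G * (v h)\<^sup>2"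
    using D by (simp add: pos_divide_le_eq power2_eq_square mult_ac)
  thus "v (poly f (newton f x)) / v (poly (pderiv f) x)
      \<le> G * (v (poly f x) / v (poly (pderiv f) x))\<^sup>2" by (simp add: vh)
qed

text \<open>Scaled by \<open>G\<close>, each step squares the quotient. Keeping \<open>B\<close> as
  a separate factor avoids dividing by \<open>G\<close>, which may be 0, and leads to the exponent
  \<open>2 ^ k - 1\<close>. The initial derivative can serve as denominator throughout, since its
  value is preserved.\<close>

lemma newton_iterates:
  fixes f :: "'a poly" and x :: 'a
  assumes "gamma_bound f x G" "poly (pderiv f) x \<noteq> 0"
  defines "B \<equiv> v (poly f x) / v (poly (pderiv f) x)"
  assumes "G * B < 1"
  shows "v (poly (pderiv f) ((newton f ^^ k) x)) = v (poly (pderiv f) x)"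
    and "gamma_bound f ((newton f ^^ k) x) G"
    and "v (poly f ((newton f ^^ k) x)) / v (poly (pderiv f) x) \<le> B * (G * B) ^ (2 ^ k - 1)"
proof -
  have G: "0 \<le> G" and B: "0 \<le> B" using assms by (simp_all add: gamma_bound_def)
  have "v (poly (pderiv f) ((newton f ^^ k) x)) = v (poly (pderiv f) x) \<and>
      gamma_bound f ((newton f ^^ k) x) G \<and>
      v (poly f ((newton f ^^ k) x)) / v (poly (pderiv f) x) \<le> B * (G * B) ^ (2 ^ k - 1)"
  proof (induction k)
    case (Suc k)
    define y where "y = (newton f ^^ k) x"
    define b where "b = v (poly f y) / v (poly (pderiv f) x)"
    have IH: "v (poly (pderiv f) y) = v (poly (pderiv f) x)" "gamma_bound f y G"
        "b \<le> B * (G * B) ^ (2 ^ k - 1)"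
      using Suc by (simp_all add: y_def b_def)
    have y: "poly (pderiv f) y \<noteq> 0" using IH(1) assms(2) v_eq_0_iff by metis
    have "G * b \<le> (G * B) * (G * B) ^ (2 ^ k - 1)"
      using mult_left_mono[OF IH(3) G] by (simp add: mult_ac)
    also have "\<dots> \<le> (G * B) * 1"
      using G B assms by (intro mult_left_mono power_le_one) auto
    finally have "G * b < 1" using assms by simp
    hence *: "G * (v (poly f y) / v (poly (pderiv f) y)) < 1" by (simp add: b_def IH(1))
    note step = newton_step[OF IH(2) y *]
    have "v (poly f (newton f y)) / v (poly (pderiv f) x) \<le> G * b\<^sup>2"
      using step(3) by (simp add: IH(1) b_def)
    also have "\<dots> \<le> G * (B * (G * B) ^ (2 ^ k - 1))\<^sup>2"
      using IH(3) G by (intro mult_left_mono power_mono) (auto simp: b_def)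
    also have "\<dots> = B * ((G * B) * (G * B) ^ ((2 ^ k - 1) * 2))"
    proof -
      have "G * (B * a ^ n)\<^sup>2 = B * ((G * B) * a ^ (n * 2))" for a and n :: nat
        by (simp add: power_mult power2_eq_square)
      thus ?thesis .
    qed
    also have "(G * B) * (G * B) ^ ((2 ^ k - 1) * 2) = (G * B) ^ Suc ((2 ^ k - 1) * 2)"
      by simp
    \<comment> \<open>Subtraction of naturals truncates, so this identity relies on 2^k being at
      least 1.\<close>
    also have "Suc ((2 ^ k - 1) * 2) = 2 ^ Suc k - 1"
    proof -
      have "(1::nat) \<le> 2 ^ k" by simp
      thus ?thesis unfolding power_Suc by linarith
    qed
    finally show ?case using step IH(1) by (simp add: y_def)
  qed (simp_all add: assms)
  thus "v (poly (pderiv f) ((newton f ^^ k) x)) = v (poly (pderiv f) x)"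
    "gamma_bound f ((newton f ^^ k) x) G"
    "v (poly f ((newton f ^^ k) x)) / v (poly (pderiv f) x) \<le> B * (G * B) ^ (2 ^ k - 1)"
    by auto
qed

text \<open>Consecutive iterates differ by \<open>b k\<close>, which decreases to 0, so the
  ultrametric inequality makes the sequence Cauchy without summing a series. Passing to the limit
  bounds the distance to \<open>z\<close> by \<open>b k\<close>, and \<open>v_dist_root\<close>
  turns this bound into an equality.\<close>

lemma convergent_newton:
  fixes f :: "'a poly" and x :: 'a
  assumes complete: "v_complete v UNIV"
    and gb: "gamma_bound f x G" and df: "poly (pderiv f) x \<noteq> 0"
  defines "B \<equiv> v (poly f x) / v (poly (pderiv f) x)"
  assumes GB: "G * B < 1"
  obtains z where "poly f z = 0" "poly (pderiv f) z \<noteq> 0"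
    "v_tendsto v (\<lambda>k. (newton f ^^ k) x) z"
    "\<And>k. v ((newton f ^^ k) x - z) = v (poly f ((newton f ^^ k) x)) / v (poly (pderiv f) x)"
proof -
  define y where "y k = (newton f ^^ k) x" for k
  define D where "D = v (poly (pderiv f) x)"
  define b where "b k = v (poly f (y k)) / D" for k
  define A where "A = G * B"
  have D: "0 < D" using df v_nonneg[of "poly (pderiv f) x"] by (simp add: D_def less_le)
  have G: "0 \<le> G" and B: "0 \<le> B" using gb by (simp_all add: gamma_bound_def B_def)
  have A: "0 \<le> A" "A < 1" using G B GB by (simp_all add: A_def)
  have it: "v (poly (pderiv f) (y k)) = D" "gamma_bound f (y k) G" "b k \<le> B * A ^ (2 ^ k - 1)" for k
    using newton_iterates[OF gb df, of k] GB by (simp_all add: y_def D_def b_def B_def A_def)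
  have dfy: "poly (pderiv f) (y k) \<noteq> 0" for k using it(1)[of k] D by auto
  have b_nonneg: "0 \<le> b k" for k using D by (simp add: b_def)
  \<comment> \<open>A geometric rate is enough to show that \<open>b\<close> tends to 0.\<close>
  have bB: "b k \<le> B * A ^ k" for k
  proof -
    have "k \<le> 2 ^ k - 1" using less_exp[of k] by linarith
    hence "B * A ^ (2 ^ k - 1) \<le> B * A ^ k" using A B by (intro mult_left_mono power_decreasing) auto
    thus ?thesis using it(3)[of k] by simp
  qed
  have Gb: "G * b k < 1" for k
  proof -
    have "b k \<le> B * 1"
      by (rule order_trans[OF bB]) (use A B in \<open>intro mult_left_mono power_le_one; simp\<close>)
    hence "G * b k \<le> G * B" using G by (simp add: mult_left_mono)
    thus ?thesis using GB by simp
  qed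
  have b_Suc: "b (Suc k) \<le> b k" for k
  proof -
    have "G * (v (poly f (y k)) / v (poly (pderiv f) (y k))) < 1"
      using Gb[of k] by (simp add: b_def it(1))
    hence "v (poly f (newton f (y k))) / D \<le> G * (b k)\<^sup>2"
      using newton_step(3)[OF it(2) dfy] by (simp add: b_def it(1))
    hence "b (Suc k) \<le> G * (b k)\<^sup>2"
      by (simp add: b_def y_def)
    also have "\<dots> = (G * b k) * b k" by (simp add: power2_eq_square)
    also have "\<dots> \<le> 1 * b k" using Gb[of k] b_nonneg by (intro mult_right_mono) auto
    finally show ?thesis by simp
  qed
  have b_anti: "b j \<le> b i" if "i \<le> j" for i j
    using lift_Suc_antimono_le[of b, OF b_Suc that] .
  have y_Suc: "v (y (Suc k) - y k) = b k" for k
    by (simp add: y_def newton_def b_def v_divide it(1)[unfolded y_def])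
  have dist_y: "v (y j - y i) \<le> b i" if "i \<le> j" for i j
    using that
  proof (induction j rule: dec_induct)
    case (step n)
    have "v (y (Suc n) - y i) \<le> max (v (y (Suc n) - y n)) (v (y n - y i))" by (rule v_triangle_max)
    also have "\<dots> \<le> b i" using step b_anti[of i n] by (simp add: y_Suc)
    finally show ?case .
  qed (simp add: b_nonneg)
  have "(\<lambda>k. B * A ^ k) \<longlonglongrightarrow> B * 0"
    using A by (intro tendsto_mult tendsto_const LIMSEQ_realpow_zero)
  hence "(\<lambda>k. B * A ^ k) \<longlonglongrightarrow> 0" by simp
  hence b_lim: "b \<longlonglongrightarrow> 0"
    by (rule tendsto_sandwich[OF _ _ tendsto_const, rotated 2]) (auto simp: b_nonneg bB)
  have "v_Cauchy v y"
    unfolding v_Cauchy_def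
  proof (intro allI impI)
    fix e :: real assume "e > 0"
    then obtain M where M: "b M < e"
      using order_tendstoD(2)[OF b_lim] by (auto simp: eventually_sequentially)
    show "\<exists>M. \<forall>m\<ge>M. \<forall>n\<ge>M. v (y m - y n) < e"
    proof (intro exI allI impI)
      fix m n assume "m \<ge> M" "n \<ge> M"
      hence "max (v (y m - y M)) (v (y M - y n)) \<le> b M"
        using dist_y[of M m] dist_y[of M n] by (simp add: v_diff_commute)
      thus "v (y m - y n) < e" using v_triangle_max[of "y m" "y n" "y M"] M by linarith
    qed
  qed
  then obtain z where z: "v_tendsto v y z"
    using complete by (auto simp: v_complete_def)
  \<comment> \<open>Let j tend to infinity in the ultrametric inequality through \<open>y j\<close>;
    its right-hand side tends to \<open>b k\<close>.\<close>
  have dist_z: "v (y k - z) \<le> b k" for k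
  proof (rule tendsto_le)
    show "(\<lambda>j. max (v (y j - z)) (b k)) \<longlonglongrightarrow> b k"
      using tendsto_max[OF z[unfolded v_tendsto_def] tendsto_const[of "b k"]] b_nonneg[of k] by simp
    show "\<forall>\<^sub>F j in sequentially. v (y k - z) \<le> max (v (y j - z)) (b k)"
    proof (rule eventually_sequentiallyI)
      fix j assume "k \<le> j"
      thus "v (y k - z) \<le> max (v (y j - z)) (b k)"
        using v_triangle_max[of "y k" z "y j"] dist_y[of k j] by (auto simp: v_diff_commute)
    qed
  qed auto
  have Gz: "G * v (z - y k) < 1" for k
    using mult_left_mono[OF dist_z[of k] G] Gb[of k] by (simp add: v_diff_commute)
  \<comment> \<open>\<open>poly f z\<close> is the sum of the linearization error at
    \<open>y k\<close>, the linear term and \<open>poly f (y k)\<close>, each of value at most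
    \<open>D * b k\<close>.\<close>
  have fz: "v (poly f z) \<le> D * b k" for k
  proof -
    define h where "h = z - y k"
    have h: "v h \<le> b k" "G * v h \<le> 1" "0 \<le> G * v h"
      using dist_z[of k] Gz[of k] G by (simp_all add: h_def v_diff_commute)
    have fy: "v (poly f (y k)) = D * b k" using D by (simp add: b_def)
    have "v (poly f z - poly f (y k) - poly (pderiv f) (y k) * h) \<le> D * v h * (G * v h)"
      using v_linearization_error_le[OF it(2)[of k] h(2)] by (simp add: it(1) h_def)
    also have "\<dots> \<le> D * b k * 1" using h D by (intro mult_mono) (auto simp: b_nonneg)
    finally have "v (poly f z - poly f (y k) - poly (pderiv f) (y k) * h) \<le> D * b k" by simp
    moreover have "v (poly (pderiv f) (y k) * h) \<le> D * b k"
      using h D by (simp add: v_mult it(1))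
    ultimately show ?thesis
      using v_add_le_max[of "poly f z - poly f (y k) - poly (pderiv f) (y k) * h" "poly (pderiv f) (y k) * h"]
        v_add_le_max[of "poly f z - poly f (y k)" "poly f (y k)"] fy by simp
  qed
  have "v (poly f z) \<le> D * 0"
    by (rule tendsto_lowerbound[OF tendsto_mult[OF tendsto_const b_lim]]) (simp_all add: fz)
  hence root: "poly f z = 0" using v_nonneg[of "poly f z"] by (simp add: order.antisym)
  \<comment> \<open>Already \<open>y 0\<close>, which is \<open>x\<close>, is close enough to
    \<open>z\<close> for the derivative to keep its value, so the root is simple.\<close>
  have "v (poly (pderiv f) z) = D"
    using v_pderiv_shift[OF it(2)[of 0] Gz[of 0] dfy[of 0]] it(1)[of 0] by simp
  hence "poly (pderiv f) z \<noteq> 0" using D by auto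
  moreover have "v (y k - z) = b k" for k
    using v_dist_root[OF it(2) dfy root] Gz[of k] by (simp add: it(1) b_def v_diff_commute)
  moreover have "v_tendsto v (\<lambda>k. (newton f ^^ k) x) z" using z by (simp add: y_def[abs_def])
  ultimately show ?thesis using that root by (simp add: y_def b_def D_def)
qed

section \<open>From real estimates to extended nonnegative values\<close>

lemma beta_eq:
  assumes "poly (pderiv f) x \<noteq> 0"
  shows "beta v f x = ennreal (v (poly f x) / v (poly (pderiv f) x))"
  using assms by (simp add: beta_def v_divide)

end

text \<open>For \<open>G = 0\<close> the quotient is \<open>top\<close> and both sides are
  true.\<close>

lemma less_one_divide_ennreal_iff:
  assumes "0 \<le> r" "0 \<le> G"
  shows "ennreal r < 1 / ennreal G \<longleftrightarrow> G * r < 1"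
proof (cases "G = 0")
  case False
  hence "1 / ennreal G = ennreal (1 / G)"
    using assms divide_ennreal[of 1 G] by simp
  thus ?thesis using assms False by (simp add: ennreal_less_iff field_simps)
qed simp

text \<open>With exponent 2^k, the bound on beta at k = 0 would read beta \<le> beta * alpha, false
  if beta > 0 and alpha < 1; hence \<open>2 ^ k - 1\<close>. Strictness is claimed for nonzero
  powers only, as otherwise both sides are 0. The last bound excludes gamma = 0, where its
  right-hand side is 0 / 0 = 0 while beta may be positive at k = 0.\<close>

theorem theorem3p8:
  fixes p :: nat and v :: "'a::field_char_0 \<Rightarrow> real" and f :: "'a poly" and x :: 'a
  assumes "is_Cp p v"
  shows "(alpha v f x < 1 \<longleftrightarrow> root_dist v f x < 1 / gamma v f x) \<and>
    (alpha v f x < 1 \<or> root_dist v f x < 1 / gamma v f x \<longrightarrow>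
      newton_well_defined f x \<and>
      (\<exists>\<zeta>. poly f \<zeta> = 0 \<and> poly (pderiv f) \<zeta> \<noteq> 0 \<and>
        converges_quadratically v (\<lambda>k. (newton f ^^ k) x) \<zeta> \<and>
        (\<forall>k::nat.
          alpha v f ((newton f ^^ k) x) \<le> alpha v f x ^ (2 ^ k) \<and>
          beta v f ((newton f ^^ k) x) \<le> beta v f x * alpha v f x ^ (2 ^ k - 1) \<and>
          gamma v f ((newton f ^^ k) x) \<le> gamma v f x \<and>
          ennreal (v ((newton f ^^ k) x - \<zeta>)) = beta v f ((newton f ^^ k) x) \<and>
          beta v f ((newton f ^^ k) x) \<le> alpha v f x ^ (2 ^ k - 1) * beta v f x \<and>
          alpha v f x ^ (2 ^ k - 1) * beta v f x \<le> alpha v f x ^ (2 ^ k - 1) / gamma v f x \<and>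
          (alpha v f x ^ (2 ^ k - 1) \<noteq> 0 \<longrightarrow>
            alpha v f x ^ (2 ^ k - 1) * beta v f x < alpha v f x ^ (2 ^ k - 1) / gamma v f x) \<and>
          (gamma v f x \<noteq> 0 \<longrightarrow>
            beta v f ((newton f ^^ k) x) \<le> alpha v f x ^ (2 ^ k) / gamma v f x))))"
proof -
  have nonarch: "nonarch_abs v" and complete: "v_complete v UNIV"
    using assms by (auto simp: is_Cp_def is_completion_def)
  interpret nonarch_field v by unfold_locales (rule nonarch)
  show ?thesis
  proof (cases "poly (pderiv f) x = 0")
    case True
    \<comment> \<open>Here alpha and gamma are \<open>top\<close> and \<open>1 / top = 0\<close>, so
      both conditions fail.\<close>
    thus ?thesis by (simp add: alpha_def gamma_def)
  next
    case df: False
    define D where "D = v (poly (pderiv f) x)"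
    define B where "B = v (poly f x) / D"
    obtain G where G: "0 \<le> G" and gamma: "gamma v f x = ennreal G" using gamma_finite[OF df] .
    have gb: "gamma_bound f x G" using gamma_le_iff[OF df G] gamma by simp
    have D: "0 < D" using df v_nonneg[of "poly (pderiv f) x"] by (simp add: D_def less_le)
    have B: "0 \<le> B" using D by (simp add: B_def)
    have beta: "beta v f x = ennreal B" by (simp add: beta_eq df B_def D_def)
    have alpha: "alpha v f x = ennreal (G * B)"
      using df G B by (simp add: alpha_def beta gamma ennreal_mult mult.commute)
    have alpha_less: "alpha v f x < 1 \<longleftrightarrow> G * B < 1"
      using G B by (simp add: alpha ennreal_less_one_iff)
    have alpha_if: "G * B < 1" if dist: "root_dist v f x < 1 / gamma v f x"
    proof -
      \<comment> \<open>An infimum strictly below the threshold is witnessed by a single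
        root.\<close>
      obtain z where z: "poly f z = 0" "ennreal (v (x - z)) < 1 / ennreal G"
        using dist by (auto simp: root_dist_def INF_less_iff gamma)
      hence "G * v (x - z) < 1" using G by (simp add: less_one_divide_ennreal_iff)
      moreover from this have "v (x - z) = B"
        using v_dist_root[OF gb df z(1)] by (simp add: B_def D_def)
      ultimately show ?thesis by simp
    qed
    show ?thesis
    proof (cases "G * B < 1")
      case False
      \<comment> \<open>Each condition implies \<open>G * B < 1\<close>, so both fail.\<close>
      thus ?thesis using alpha_if alpha_less by blast
    next
      case GB: True
      define y where "y k = (newton f ^^ k) x" for k
      define A where "A = G * B"
      define b where "b k = v (poly f (y k)) / D" for k
      have A: "0 \<le> A" "A < 1" using G B GB by (simp_all add: A_def)
      have GB': "G * (v (poly f x) / v (poly (pderiv f) x)) < 1" using GB by (simp add: B_def D_def)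
      have it: "v (poly (pderiv f) (y k)) = D" "gamma_bound f (y k) G"
          "b k \<le> B * A ^ (2 ^ k - 1)" for k
        using newton_iterates[OF gb df GB', of k] by (simp_all add: y_def D_def b_def B_def A_def)
      have dfy: "poly (pderiv f) (y k) \<noteq> 0" for k using it(1)[of k] D by auto
      have b_nonneg: "0 \<le> b k" for k using D by (simp add: b_def)
      obtain z where z: "poly f z = 0" "poly (pderiv f) z \<noteq> 0" "v_tendsto v y z"
          and dist_z: "\<And>k. v (y k - z) = b k"
        using convergent_newton[OF complete gb df GB'] by (auto simp: y_def[abs_def] b_def D_def B_def)
      have "b 0 = B" by (simp add: b_def y_def B_def)
      \<comment> \<open>The limit of the Newton sequence is itself a root close enough to
        \<open>x\<close>: its distance is \<open>b 0\<close>, that is \<open>B\<close>.\<close>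
      have "root_dist v f x \<le> ennreal (v (x - z))"
        unfolding root_dist_def using z(1) by (intro INF_lower) simp
      also have "\<dots> < 1 / gamma v f x"
        using dist_z[of 0] G B GB \<open>b 0 = B\<close>
        by (simp add: gamma y_def less_one_divide_ennreal_iff)
      finally have root_dist: "root_dist v f x < 1 / gamma v f x" .
      \<comment> \<open>As \<open>b k\<close> is the distance to \<open>z\<close>, this is quadratic
        convergence with constant \<open>G\<close>.\<close>
      have "b (Suc k) \<le> G * (b k)\<^sup>2" for k
      proof -
        have "b k \<le> B * 1"
          by (rule order_trans[OF it(3)]) (use A B in \<open>intro mult_left_mono power_le_one; simp\<close>)
        hence "G * b k \<le> G * B" using G by (simp add: mult_left_mono)
        hence "G * (v (poly f (y k)) / v (poly (pderiv f) (y k))) < 1"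
          using GB by (simp add: it(1) b_def)
        hence "v (poly f (newton f (y k))) / D \<le> G * (b k)\<^sup>2"
          using newton_step(3)[OF it(2) dfy] by (simp add: b_def it(1))
        thus ?thesis by (simp add: b_def y_def)
      qed
      hence quad: "converges_quadratically v y z"
        using z(3) by (auto simp: converges_quadratically_def dist_z)
      have beta_y: "beta v f (y k) = ennreal (b k)" for k
        by (simp add: beta_eq[OF dfy] it(1) b_def)
      have gamma_y: "gamma v f (y k) \<le> ennreal G" for k
        using gamma_le_iff[OF dfy G] it(2) by simp
      have alpha_pow: "alpha v f x ^ n = ennreal (A ^ n)" for n
        using A by (simp add: alpha A_def[symmetric] ennreal_power)
      \<comment> \<open>One more factor \<open>G\<close> raises the exponent to 2^k, as the bound on
        alpha and the final quotient bound require.\<close>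
      have BA: "B * A ^ (2 ^ k - 1) * G = A ^ (2 ^ k)" for k
        using power_minus_mult[of "2 ^ k" A] by (simp add: A_def mult_ac)
      have bound_k: "beta v f (y k) \<le> alpha v f x ^ (2 ^ k - 1) * beta v f x" for k
        unfolding beta_y alpha_pow beta using it(3)[of k] A B
        by (simp add: ennreal_mult[symmetric] mult.commute ennreal_leI)
      have alpha_y: "alpha v f (y k) \<le> alpha v f x ^ (2 ^ k)" for k
      proof -
        have "alpha v f (y k) \<le> ennreal (b k) * ennreal G"
          using dfy gamma_y by (simp add: alpha_def beta_y mult_left_mono)
        also have "\<dots> = ennreal (b k * G)" using b_nonneg G by (simp add: ennreal_mult)
        also have "\<dots> \<le> ennreal (B * A ^ (2 ^ k - 1) * G)"
          using it(3)[of k] G by (intro ennreal_leI mult_right_mono)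
        finally show ?thesis by (simp only: BA alpha_pow)
      qed
      have strict: "alpha v f x ^ n * beta v f x < alpha v f x ^ n / gamma v f x"
        if "alpha v f x ^ n \<noteq> 0" for n
      proof (cases "G = 0")
        \<comment> \<open>A nonzero power divided by gamma = 0 is \<open>top\<close>, which exceeds
          every real value.\<close>
        case True
        thus ?thesis using that A B
          by (simp add: gamma alpha_pow beta ennreal_mult[symmetric])
      next
        case False
        have pos: "0 < A ^ n"
          using that ennreal_neg[of "A ^ n"] by (simp only: alpha_pow) (meson not_less)
        have "A ^ n * B < A ^ n * (1 / G)"
          using pos False G GB by (intro mult_strict_left_mono) (simp_all add: field_simps)
        hence "ennreal (A ^ n * B) < ennreal (A ^ n / G)"
          using pos False G by (intro ennreal_lessI) (simp_all add: field_simps)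
        thus ?thesis using False A B G
          by (simp add: gamma alpha_pow beta ennreal_mult[symmetric] divide_ennreal)
      qed
      have le: "alpha v f x ^ n * beta v f x \<le> alpha v f x ^ n / gamma v f x" for n
        using strict[of n] by (cases "alpha v f x ^ n = 0") (simp_all only: mult_zero_left zero_le less_imp_le not_False_eq_True)
      have last: "beta v f (y k) \<le> alpha v f x ^ (2 ^ k) / gamma v f x" if "gamma v f x \<noteq> 0" for k
      proof -
        have "0 < G" using that G by (cases "G = 0") (simp_all add: gamma)
        moreover from this have "b k \<le> A ^ (2 ^ k) / G"
          using it(3)[of k] BA[of k] by (simp add: pos_le_divide_eq mult_right_mono flip: BA)
        ultimately show ?thesis using A
          by (simp add: gamma alpha_pow beta_y divide_ennreal ennreal_leI)
      qed
      have "newton_well_defined f x" using dfy by (simp add: newton_well_defined_def y_def)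
      moreover have "alpha v f x < 1" using GB alpha_less by simp
      moreover have "converges_quadratically v (\<lambda>k. (newton f ^^ k) x) z"
        using quad by (simp add: y_def[abs_def])
      moreover have "beta v f (y k) \<le> beta v f x * alpha v f x ^ (2 ^ k - 1)" for k
        using bound_k[of k] by (simp only: mult.commute)
      moreover have "gamma v f (y k) \<le> gamma v f x" for k
        using gamma_y by (simp add: gamma)
      moreover have "ennreal (v (y k - z)) = beta v f (y k)" for k
        by (simp add: beta_y dist_z)
      ultimately show ?thesis
        using root_dist z(1,2) alpha_y bound_k strict le last unfolding y_def by blast
    qed
  qed
qed

end
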